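(* The combinatorial description of the coproduct coincides with the recursive one: for every forest $F\in\mathcal{F}_\ell(\tilde X)$, $$\Delta_\epsilon(F)=\sum_{a\in V(F)}B_a\otimes R_a,$$ where $\Delta_\epsilon$ is the recursively defined coproduct, and the right-hand side is understood to be $0$ when $F=1$.
   Context: Let $\mathbf{k}$ be a commutative ring with unit; linear maps and tensor products are over $\mathbf{k}$. For an associative algebra $A$, view $A\otimes A$ as an $A$-bimodule via $a\cdot(b\otimes c):=ab\otimes c$ and $(b\otimes c)\cdot a:=b\otimes ca$. Let $X$ be a set, $\sigma\notin X$ a symbol, and $\tilde X:=X\sqcup\{\sigma\}$. Consider planar rooted trees whose vertices are decorated by elements of $\tilde X$ in such a way that elements of $X$ decorate leaves only (all internal vertices, and possibly some leaves, are decorated by $\sigma$; the vertex of a one-vertex tree counts as a leaf). Let $\mathcal{T}_\ell(\tilde X)$ be the set of such trees, including by convention the empty tree $1$. Let $\mathcal{F}_\ell(\tilde X)$ be the free monoid generated by the nonempty such trees (planar decorated rooted forests, with concatenation as product and $1$ as identity), and let $H_\ell(\tilde X):=\mathbf{k}\mathcal{F}_\ell(\tilde X)$ be the free $\mathbf{k}$-module on it, with the linearly extended concatenation product and unit $1$. For $x\in\tilde X$, $\bullet_x$ is the one-vertex tree decorated by $x$. $B^+:H_\ell(\tilde X)\to H_\ell(\tilde X)$ is the linear grafting map with $B^+(1)=\bullet_\sigma$ that sends a forest to the tree obtained by grafting it onto a new root decorated by $\sigma$. Every nonempty tree in $\mathcal{T}_\ell(\tilde X)$ is either $\bullet_x$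 with $x\in X$ or $B^+(\bar F)$ for a unique forest $\bar F\in\mathcal{F}_\ell(\tilde X)$. The linear map $\Delta_\epsilon:H_\ell(\tilde X)\to H_\ell(\tilde X)\otimes H_\ell(\tilde X)$ is defined recursively on forests by: $\Delta_\epsilon(1)=0$; $\Delta_\epsilon(\bullet_x)=1\otimes 1$ for $x\in X$; $\Delta_\epsilon(B^+(\bar F))=\bar F\otimes 1+(\mathrm{id}\otimes B^+)\Delta_\epsilon(\bar F)$ for $\bar F\in\mathcal{F}_\ell(\tilde X)$; and $\Delta_\epsilon(T_1T_2\cdots T_m)=T_1\cdot\Delta_\epsilon(T_2\cdots T_m)+\Delta_\epsilon(T_1)\cdot(T_2\cdots T_m)$ for nonempty trees $T_1,\dots,T_m\in\mathcal{T}_\ell(\tilde X)$, $m\ge 2$. Order on vertices. For a forest $F=T_1\cdots T_n$ ($n\ge1$, $T_i\in\mathcal{T}_\ell(\tilde X)$) let $V(F)$ be its set of vertices, with edges oriented from roots to leaves. For $a,b\in V(F)$: $a\le_{\mathrm h}b$ if there is a directed path from $a$ to $b$ in $F$; $a\le_{\mathrm l}b$ if $a,b$ are not comparable for $\le_{\mathrm h}$ and either $a$ is a vertex of $T_i$ and $b$ is a vertex of $T_j$ with $1\le j<i\le n$, or $a,b$ are vertices of the same $T_i$ and (recursively) $a\le_{\mathrm l}b$ in the forest obtained from $T_i$ by deleting its root; $a\le_{\mathrm{h,l}}b$ if $a\le_{\mathrm h}b$ or $a\le_{\mathrm l}b$. The relation $\le_{\mathrm{h,l}}$ is a linear order on $V(F)$;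 write $a<_{\mathrm{h,l}}b$ if $a\le_{\mathrm{h,l}}b$ and $a\ne b$. For $a\in V(F)$, $B_a$ is the subgraph of $F$ induced by $\{b\in V(F): a<_{\mathrm{h,l}}b\}$ and $R_a$ is the subgraph of $F$ induced by $\{b\in V(F): b<_{\mathrm{h,l}}a\}$; with the inherited decorations and planar structure both are forests in $\mathcal{F}_\ell(\tilde X)$ (the empty induced subgraph being $1$). *)

theory Defs
  imports "HOL-Library.Poly_Mapping"
begin

section \<open>Free modules and their tensor products\<close>

text \<open>The free module on \<open>'b\<close> is the type \<open>'b \<Rightarrow>\<^sub>0 'k\<close> of finitely supported functions. The sort
  \<open>{comm_ring, comm_monoid_mult}\<close> is that of commutative rings with unit; unlike \<open>comm_ring_1\<close>
  it does not exclude the zero ring.\<close>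

definition basis :: "'b \<Rightarrow> ('b \<Rightarrow>\<^sub>0 'k::{comm_ring, comm_monoid_mult})" where
  "basis b = Poly_Mapping.single b 1"

definition scale :: "'k \<Rightarrow> ('b \<Rightarrow>\<^sub>0 'k) \<Rightarrow> ('b \<Rightarrow>\<^sub>0 'k::{comm_ring, comm_monoid_mult})" where
  "scale c h = Poly_Mapping.map ((*) c) h"

definition lin_ext ::
  "('b \<Rightarrow> ('c \<Rightarrow>\<^sub>0 'k)) \<Rightarrow> ('b \<Rightarrow>\<^sub>0 'k) \<Rightarrow> ('c \<Rightarrow>\<^sub>0 'k::{comm_ring, comm_monoid_mult})" where
  "lin_ext f h = (\<Sum>b\<in>Poly_Mapping.keys h. scale (Poly_Mapping.lookup h b) (f b))"

text \<open>The tensor product of the free modules on \<open>'b\<close> and \<open>'c\<close> is realised as the free module on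
  \<open>'b \<times> 'c\<close>; its universal property is \<open>tensor_universal\<close> below.\<close>

definition tensor :: "('b \<Rightarrow>\<^sub>0 'k) \<Rightarrow> ('c \<Rightarrow>\<^sub>0 'k) \<Rightarrow> ('b \<times> 'c \<Rightarrow>\<^sub>0 'k::{comm_ring, comm_monoid_mult})"
    (infixr \<open>\<otimes>\<close> 70) where
  "h \<otimes> h' = (\<Sum>b\<in>Poly_Mapping.keys h. \<Sum>c\<in>Poly_Mapping.keys h'.
     Poly_Mapping.single (b, c) (Poly_Mapping.lookup h b * Poly_Mapping.lookup h' c))"

definition tensor_map ::
  "(('b \<Rightarrow>\<^sub>0 'k) \<Rightarrow> ('d \<Rightarrow>\<^sub>0 'k)) \<Rightarrow> (('c \<Rightarrow>\<^sub>0 'k) \<Rightarrow> ('e \<Rightarrow>\<^sub>0 'k))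
    \<Rightarrow> ('b \<times> 'c \<Rightarrow>\<^sub>0 'k) \<Rightarrow> ('d \<times> 'e \<Rightarrow>\<^sub>0 'k::{comm_ring, comm_monoid_mult})" where
  "tensor_map f g = lin_ext (\<lambda>(b, c). f (basis b) \<otimes> g (basis c))"

lemma lookup_scale [simp]: "Poly_Mapping.lookup (scale c h) b = c * Poly_Mapping.lookup h b"
  by (simp add: scale_def Poly_Mapping.map.rep_eq when_def)

lemma lookup_lin_ext:
  "Poly_Mapping.lookup (lin_ext f h) c =
    (\<Sum>b\<in>Poly_Mapping.keys h. Poly_Mapping.lookup h b * Poly_Mapping.lookup (f b) c)"
  by (simp add: lin_ext_def lookup_sum)

lemma lookup_tensor:
  "Poly_Mapping.lookup (h \<otimes> h') (b, c) = Poly_Mapping.lookup h b * Poly_Mapping.lookup h' c"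
proof -
  have "Poly_Mapping.lookup (h \<otimes> h') (b, c) =
     (\<Sum>x\<in>Poly_Mapping.keys h. \<Sum>y\<in>Poly_Mapping.keys h'.
       (if x = b then if y = c then Poly_Mapping.lookup h b * Poly_Mapping.lookup h' c else 0 else 0))"
    unfolding tensor_def by (auto simp: lookup_sum lookup_single when_def intro!: sum.cong)
  also have "\<dots> = (\<Sum>x\<in>Poly_Mapping.keys h. if x = b then
       (\<Sum>y\<in>Poly_Mapping.keys h'. if y = c then Poly_Mapping.lookup h b * Poly_Mapping.lookup h' c else 0)
       else 0)"
    by (intro sum.cong) auto
  also have "\<dots> = Poly_Mapping.lookup h b * Poly_Mapping.lookup h' c"
    by (auto simp: sum.delta in_keys_iff)
  finally show ?thesis .
qed

lemma tensor_bilinear: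
  "(h + g) \<otimes> h' = h \<otimes> h' + g \<otimes> h'"
  "h \<otimes> (h' + g') = h \<otimes> h' + h \<otimes> g'"
  "scale a h \<otimes> h' = scale a (h \<otimes> h')"
  "h \<otimes> scale a h' = scale a (h \<otimes> h')"
  by (rule poly_mapping_eqI, rename_tac p, case_tac p,
      simp add: lookup_tensor lookup_add algebra_simps)+

lemma tensor_basis: "basis b \<otimes> basis c = basis (b, c)"
  by (rule poly_mapping_eqI, rename_tac p, case_tac p)
    (auto simp: lookup_tensor basis_def lookup_single when_def)

lemma basis_decomp: "h = (\<Sum>b\<in>Poly_Mapping.keys h. scale (Poly_Mapping.lookup h b) (basis b))"
proof (rule poly_mapping_eqI)
  fix x
  have "Poly_Mapping.lookup (\<Sum>b\<in>Poly_Mapping.keys h. scale (Poly_Mapping.lookup h b) (basis b)) x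
    = (\<Sum>b\<in>Poly_Mapping.keys h. if b = x then Poly_Mapping.lookup h x else 0)"
    by (auto simp: lookup_sum basis_def lookup_single when_def if_distrib intro!: sum.cong simp del: sum.delta)
  also have "\<dots> = Poly_Mapping.lookup h x"
    by (auto simp: sum.delta in_keys_iff)
  finally show "Poly_Mapping.lookup h x = Poly_Mapping.lookup
    (\<Sum>b\<in>Poly_Mapping.keys h. scale (Poly_Mapping.lookup h b) (basis b)) x" by simp
qed

lemma tensor_universal:
  fixes s :: "'k::{comm_ring, comm_monoid_mult} \<Rightarrow> 'm::ab_group_add \<Rightarrow> 'm"
    and f :: "('b \<Rightarrow>\<^sub>0 'k) \<Rightarrow> ('c \<Rightarrow>\<^sub>0 'k) \<Rightarrow> 'm"
  assumes module: "\<And>a x y. s a (x + y) = s a x + s a y" "\<And>a b x. s (a + b) x = s a x + s b x"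
      "\<And>a b x. s a (s b x) = s (a * b) x" "\<And>x. s 1 x = x"
    and bilinear: "\<And>h g h'. f (h + g) h' = f h h' + f g h'" "\<And>h h' g'. f h (h' + g') = f h h' + f h g'"
      "\<And>a h h'. f (scale a h) h' = s a (f h h')" "\<And>a h h'. f h (scale a h') = s a (f h h')"
  shows "\<exists>!g :: ('b \<times> 'c \<Rightarrow>\<^sub>0 'k) \<Rightarrow> 'm.
    (\<forall>t u. g (t + u) = g t + g u) \<and> (\<forall>a t. g (scale a t) = s a (g t)) \<and> (\<forall>h h'. g (h \<otimes> h') = f h h')"
proof -
  have s0 [simp]: "s 0 x = 0" for x using module(2)[of 0 0 x] by simp
  have s0' [simp]: "s a 0 = 0" for a using module(1)[of a 0 0] by simp
  have f0 [simp]: "f 0 h' = 0" for h' using bilinear(1)[of 0 0 h'] by simp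
  have f0' [simp]: "f h 0 = 0" for h using bilinear(2)[of h 0 0] by simp
  have fsum: "f (\<Sum>i\<in>I. v i) h' = (\<Sum>i\<in>I. f (v i) h')" for I :: "'b set" and v h'
    by (induction I rule: infinite_finite_induct) (auto simp: bilinear)
  have fsum': "f h (\<Sum>i\<in>I. v i) = (\<Sum>i\<in>I. f h (v i))" for I :: "'c set" and v h
    by (induction I rule: infinite_finite_induct) (auto simp: bilinear)
  have ssum: "s a (\<Sum>i\<in>I. v i) = (\<Sum>i\<in>I. s a (v i))" for a v and I :: "'i set"
    by (induction I rule: infinite_finite_induct) (auto simp: module)
  define g where "g t = (\<Sum>p\<in>Poly_Mapping.keys t. s (Poly_Mapping.lookup t p) (f (basis (fst p)) (basis (snd p))))"
    for t :: "'b \<times> 'c \<Rightarrow>\<^sub>0 'k"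
  have g_sup: "g t = (\<Sum>p\<in>P. s (Poly_Mapping.lookup t p) (f (basis (fst p)) (basis (snd p))))"
    if "finite P" "Poly_Mapping.keys t \<subseteq> P" for P t
    unfolding g_def using that by (intro sum.mono_neutral_left) (auto simp: in_keys_iff)
  have g_add: "g (t + u) = g t + g u" for t u
  proof -
    let ?P = "Poly_Mapping.keys t \<union> Poly_Mapping.keys u"
    show ?thesis
      using g_sup[of ?P "t + u"] g_sup[of ?P t] g_sup[of ?P u] Poly_Mapping.keys_add[of t u]
      by (simp add: lookup_add module sum.distrib)
  qed
  have g_scale: "g (scale a t) = s a (g t)" for a t
  proof -
    have "g (scale a t) = (\<Sum>p\<in>Poly_Mapping.keys t.
        s (Poly_Mapping.lookup (scale a t) p) (f (basis (fst p)) (basis (snd p))))"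
      by (rule g_sup) (auto simp: in_keys_iff)
    then show ?thesis by (simp add: g_def ssum module(3))
  qed
  have g_tensor: "g (h \<otimes> h') = f h h'" for h h'
  proof -
    have "g (h \<otimes> h') = (\<Sum>p\<in>Poly_Mapping.keys h \<times> Poly_Mapping.keys h'.
        s (Poly_Mapping.lookup (h \<otimes> h') p) (f (basis (fst p)) (basis (snd p))))"
      by (rule g_sup) (auto simp: in_keys_iff lookup_tensor)
    also have "\<dots> = (\<Sum>b\<in>Poly_Mapping.keys h. \<Sum>c\<in>Poly_Mapping.keys h'.
        s (Poly_Mapping.lookup h b) (s (Poly_Mapping.lookup h' c) (f (basis b) (basis c))))"
      by (simp add: sum.cartesian_product lookup_tensor module(3) case_prod_unfold
          flip: surjective_pairing)
         (auto intro!: sum.cong simp: lookup_tensor)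
    also have "\<dots> = f (\<Sum>b\<in>Poly_Mapping.keys h. scale (Poly_Mapping.lookup h b) (basis b))
        (\<Sum>c\<in>Poly_Mapping.keys h'. scale (Poly_Mapping.lookup h' c) (basis c))"
      by (subst sum.swap)
         (simp add: fsum fsum' bilinear ssum module(3) mult.commute[of "Poly_Mapping.lookup h _"])
    finally show ?thesis by (simp flip: basis_decomp)
  qed
  show ?thesis
  proof (rule ex1I[of _ g], goal_cases)
    case 1
    show ?case using g_add g_scale g_tensor by blast
  next
    case (2 g')
    then have add: "g' (t + u) = g' t + g' u" and sc: "g' (scale a t) = s a (g' t)"
      and te: "g' (h \<otimes> h') = f h h'" for t u a h h' by blast+
    have 0: "g' 0 = 0" using add[of 0 0] by simp
    have gsum: "g' (\<Sum>i\<in>I. v i) = (\<Sum>i\<in>I. g' (v i))" for I :: "('b \<times> 'c) set" and v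
      by (induction I rule: infinite_finite_induct) (auto simp: add 0)
    show "g' = g"
    proof
      fix t
      have "g' t = g' (\<Sum>p\<in>Poly_Mapping.keys t. scale (Poly_Mapping.lookup t p) (basis p))"
        by (simp flip: basis_decomp)
      also have "\<dots> = g t"
        unfolding gsum sc g_def
        by (intro sum.cong refl) (simp add: tensor_basis flip: te)
      finally show "g' t = g t" .
    qed
  qed
qed


section \<open>Decorated planar rooted forests\<close>

text \<open>The set \<open>X\<close> is the type \<open>'x\<close>. \<open>Leaf x\<close> is the one-vertex tree decorated by \<open>x\<close>; the root of
  \<open>Graft ts\<close> is decorated by \<open>\<sigma>\<close>, so that \<open>Graft []\<close> is the one-vertex tree decorated by \<open>\<sigma>\<close>.
  All trees of this type are nonempty; the empty tree is the empty forest \<open>[]\<close>.\<close>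

datatype 'x tree = Leaf 'x | Graft (children: "'x tree list")
  where "children (Leaf x) = []"

type_synonym 'x forest = "'x tree list"

type_synonym ('x, 'k) H = "'x forest \<Rightarrow>\<^sub>0 'k"

type_synonym ('x, 'k) H2 = "'x forest \<times> 'x forest \<Rightarrow>\<^sub>0 'k"

definition hmult :: "('x, 'k) H \<Rightarrow> ('x, 'k) H \<Rightarrow> ('x, 'k::{comm_ring, comm_monoid_mult}) H" where
  "hmult g h = lin_ext (\<lambda>F. lin_ext (\<lambda>G. basis (F @ G)) h) g"

definition Bplus :: "('x, 'k) H \<Rightarrow> ('x, 'k::{comm_ring, comm_monoid_mult}) H" where
  "Bplus = lin_ext (\<lambda>F. basis [Graft F])"

definition lact :: "('x, 'k) H \<Rightarrow> ('x, 'k) H2 \<Rightarrow> ('x, 'k::{comm_ring, comm_monoid_mult}) H2" where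
  "lact h = tensor_map (\<lambda>b. hmult h b) id"

definition ract :: "('x, 'k) H2 \<Rightarrow> ('x, 'k) H \<Rightarrow> ('x, 'k::{comm_ring, comm_monoid_mult}) H2" where
  "ract t h = tensor_map id (\<lambda>c. hmult c h) t"

fun Delta_forest :: "'x forest \<Rightarrow> ('x, 'k::{comm_ring, comm_monoid_mult}) H2" where
  "Delta_forest [] = 0"
| "Delta_forest [Leaf x] = basis [] \<otimes> basis []"
| "Delta_forest [Graft F] = basis F \<otimes> basis [] + tensor_map id Bplus (Delta_forest F)"
| "Delta_forest (T # T' # Ts) =
     lact (basis [T]) (Delta_forest (T' # Ts)) + ract (Delta_forest [T]) (basis (T' # Ts))"

definition Delta :: "('x, 'k) H \<Rightarrow> ('x, 'k::{comm_ring, comm_monoid_mult}) H2" where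
  "Delta = lin_ext Delta_forest"


section \<open>Vertices, induced subforests and the order\<close>

text \<open>A vertex is encoded by its address: \<open>[i]\<close> is the root of the tree \<open>F ! i\<close>, and \<open>i # p\<close>
  for \<open>p\<close> nonempty is the vertex \<open>p\<close> of the forest obtained from \<open>F ! i\<close> by deleting its root.
  In particular the parent of a non-root vertex \<open>p\<close> is \<open>butlast p\<close>. The list enumerates the
  vertices in planar preorder.\<close>

type_synonym vertex = "nat list"

lemma Suc_size_nth_le:
  fixes F :: "'x forest"
  shows "i < length F \<Longrightarrow> Suc (size (F ! i)) \<le> size_list size F"
proof (induction F arbitrary: i)
  case (Cons T F)
  show ?case
  proof (cases i)
    case (Suc j)
    with Cons have "Suc (size (F ! j)) \<le> size_list size F" by simp
    with Suc show ?thesis by simp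
  qed simp
qed simp

lemma size_nth [termination_simp]:
  fixes F :: "'x forest"
  shows "i < length F \<Longrightarrow> size (F ! i) < Suc (size_list size F)"
  using Suc_size_nth_le[of i F] by simp

lemma size_children [termination_simp]:
  fixes F :: "'x forest"
  assumes "i < length F"
  shows "size_list size (children (F ! i)) < size_list size F"
proof -
  have "size_list size (children T) < Suc (size T)" for T :: "'x tree"
    by (cases T) auto
  moreover note Suc_size_nth_le[OF assms]
  ultimately show ?thesis by (meson order_less_le_trans)
qed

fun vertex_list :: "'x forest \<Rightarrow> vertex list" where
  "vertex_list F = concat (map (\<lambda>i. [i] # map ((#) i) (vertex_list (children (F ! i)))) [0..<length F])"

declare vertex_list.simps [simp del]

definition V :: "'x forest \<Rightarrow> vertex set" where
  "V F = set (vertex_list F)"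

definition edges :: "'x forest \<Rightarrow> (vertex \<times> vertex) set" where
  "edges F = {(p, p @ [i]) | p i. p \<in> V F \<and> p @ [i] \<in> V F}"

definition le_h :: "'x forest \<Rightarrow> vertex \<Rightarrow> vertex \<Rightarrow> bool" where
  "le_h F a b \<longleftrightarrow> a \<in> V F \<and> b \<in> V F \<and> (a, b) \<in> (edges F)\<^sup>*"

fun le_l :: "'x forest \<Rightarrow> vertex \<Rightarrow> vertex \<Rightarrow> bool" where
  "le_l F (i # p) (j # q) \<longleftrightarrow> i # p \<in> V F \<and> j # q \<in> V F \<and>
     \<not> le_h F (i # p) (j # q) \<and> \<not> le_h F (j # q) (i # p) \<and>
     (j < i \<or> i = j \<and> le_l (children (F ! i)) p q)"
| "le_l F _ _ \<longleftrightarrow> False"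

definition le_hl :: "'x forest \<Rightarrow> vertex \<Rightarrow> vertex \<Rightarrow> bool" where
  "le_hl F a b \<longleftrightarrow> le_h F a b \<or> le_l F a b"

definition less_hl :: "'x forest \<Rightarrow> vertex \<Rightarrow> vertex \<Rightarrow> bool" where
  "less_hl F a b \<longleftrightarrow> le_hl F a b \<and> a \<noteq> b"

fun tree_at :: "'x forest \<Rightarrow> vertex \<Rightarrow> 'x tree" where
  "tree_at F [i] = F ! i"
| "tree_at F (i # p) = tree_at (children (F ! i)) p"

text \<open>The connected component of the root in the subgraph of a tree induced by its root and \<open>S\<close>,
  where the addresses in \<open>S\<close> refer to the forest obtained by deleting the root.\<close>

fun root_component :: "vertex set \<Rightarrow> 'x tree \<Rightarrow> 'x tree" where
  "root_component S (Leaf x) = Leaf x"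
| "root_component S (Graft ts) =
     Graft (map (\<lambda>i. root_component {p. i # p \<in> S} (ts ! i)) (filter (\<lambda>i. [i] \<in> S) [0..<length ts]))"

text \<open>The subgraph of \<open>F\<close> induced by \<open>S \<subseteq> V F\<close>: its components are rooted at the vertices of \<open>S\<close>
  whose parent is not in \<open>S\<close> (in particular, at the roots of \<open>F\<close> lying in \<open>S\<close>, as \<open>[] \<notin> V F\<close>),
  and are listed in the planar order of these vertices.\<close>

definition induced :: "'x forest \<Rightarrow> vertex set \<Rightarrow> 'x forest" where
  "induced F S = map (\<lambda>p. root_component {q. p @ q \<in> S} (tree_at F p))
     (filter (\<lambda>p. p \<in> S \<and> butlast p \<notin> S) (vertex_list F))"

definition B :: "'x forest \<Rightarrow> vertex \<Rightarrow> 'x forest" where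
  "B F a = induced F {b \<in> V F. less_hl F a b}"

definition R :: "'x forest \<Rightarrow> vertex \<Rightarrow> 'x forest" where
  "R F a = induced F {b \<in> V F. less_hl F b a}"

end

theory Submission
  imports Defs
begin

text \<open>On addresses, \<open>\<le>\<^sub>h\<^sub>,\<^sub>l\<close> is a lexicographic order: a proper prefix is smaller, and at the first
  difference the larger index is smaller. In this form both sides obey the same recursion. In \<open>T F\<close>
  every vertex of \<open>F\<close> lies below every vertex of \<open>T\<close>, so \<open>B\<close> gains the factor \<open>T\<close> for vertices of
  \<open>F\<close>, and \<open>R\<close> gains \<open>F\<close> for vertices of \<open>T\<close>. In a grafted tree the root is the minimum; it
  contributes \<open>F \<otimes> 1\<close>, and it is joined to every other \<open>R\<close>, which is again grafted because \<open>R\<close> is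
  closed under ancestors.\<close>

section \<open>Linear extensions\<close>

text \<open>Coefficients off the support vanish. A common index set is needed to compare supports
  under addition, where terms may cancel.\<close>

lemma lin_ext_superset:
  fixes h :: "'b \<Rightarrow>\<^sub>0 'k::{comm_ring, comm_monoid_mult}"
  assumes "finite P" "Poly_Mapping.keys h \<subseteq> P"
  shows "lin_ext f h = (\<Sum>b\<in>P. scale (Poly_Mapping.lookup h b) (f b))"
  unfolding lin_ext_def using assms
  by (intro sum.mono_neutral_left) (auto simp: in_keys_iff intro!: poly_mapping_eqI)

lemma lin_ext_zero [simp]: "lin_ext f 0 = 0"
  by (simp add: lin_ext_def)

lemma lin_ext_add:
  fixes h g :: "'b \<Rightarrow>\<^sub>0 'k::{comm_ring, comm_monoid_mult}" and f :: "'b \<Rightarrow> 'c \<Rightarrow>\<^sub>0 'k"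
  shows "lin_ext f (h + g) = lin_ext f h + lin_ext f g"
proof -
  let ?P = "Poly_Mapping.keys h \<union> Poly_Mapping.keys g"
  have "scale (a + b) x = scale a x + scale b x" for a b and x :: "'c \<Rightarrow>\<^sub>0 'k"
    by (rule poly_mapping_eqI) (simp add: lookup_add distrib_right)
  then show ?thesis
    using lin_ext_superset[of ?P "h + g" f] lin_ext_superset[of ?P h f] lin_ext_superset[of ?P g f]
      Poly_Mapping.keys_add[of h g]
    by (simp add: lookup_add sum.distrib)
qed

lemma lin_ext_sum: "lin_ext f (\<Sum>i\<in>I. h i) = (\<Sum>i\<in>I. lin_ext f (h i))"
  by (induction I rule: infinite_finite_induct) (auto simp: lin_ext_add)

lemma lin_ext_basis [simp]:
  fixes f :: "'b \<Rightarrow> 'c \<Rightarrow>\<^sub>0 'k::{comm_ring, comm_monoid_mult}"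
  shows "lin_ext f (basis b) = f b"
proof -
  have "lin_ext f (basis b) = (\<Sum>x\<in>{b}. scale (Poly_Mapping.lookup (basis b) x) (f x))"
    \<comment> \<open>Only an inclusion of supports is available: over the zero ring
      \<open>basis b\<close> has empty support.\<close>
    by (rule lin_ext_superset) (auto simp: basis_def)
  also have "\<dots> = f b"
    by (rule poly_mapping_eqI) (simp add: basis_def)
  finally show ?thesis .
qed

lemma tensor_map_sum: "tensor_map f g (\<Sum>i\<in>I. h i) = (\<Sum>i\<in>I. tensor_map f g (h i))"
  by (simp add: tensor_map_def lin_ext_sum)

lemma tensor_map_basis: "tensor_map f g (basis b \<otimes> basis c) = f (basis b) \<otimes> g (basis c)"
  by (simp add: tensor_map_def tensor_basis)

lemma hmult_basis: "hmult (basis F) (basis G) = basis (F @ G)"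
  by (simp add: hmult_def)

lemma Bplus_basis: "Bplus (basis F) = basis [Graft F]"
  by (simp add: Bplus_def)


section \<open>Vertices and the order on addresses\<close>

lemma Nil_notin_V [simp]: "[] \<notin> V F"
  by (subst V_def, subst vertex_list.simps) auto

lemma Cons_in_V [simp]:
  "i # p \<in> V F \<longleftrightarrow> i < length F \<and> (p = [] \<or> p \<in> V (children (F ! i)))"
  by (subst V_def, subst vertex_list.simps) (auto simp: V_def)

lemma finite_V [simp]: "finite (V F)"
  by (simp add: V_def)

lemma V_append_left: "p @ q \<in> V F \<Longrightarrow> p \<noteq> [] \<Longrightarrow> p \<in> V F"
proof (induction p arbitrary: F)
  case (Cons i p)
  then show ?case by (cases "p = []") auto
qed simp

text \<open>Each edge appends one index. Conversely, nonempty prefixes of a vertex are vertices, so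
  the path through them stays in \<open>V F\<close>.\<close>

lemma le_h_iff: "le_h F a b \<longleftrightarrow> a \<in> V F \<and> b \<in> V F \<and> (\<exists>r. b = a @ r)"
proof -
  have "\<exists>r. b = a @ r" if "(a, b) \<in> (edges F)\<^sup>*"
    using that by induction (auto simp: edges_def)
  moreover have "(a, a @ r) \<in> (edges F)\<^sup>*" if "a \<in> V F" "a @ r \<in> V F" for r
    using that(2)
  proof (induction r rule: rev_induct)
    case (snoc i r)
    have "a \<noteq> []" using that(1) by auto
    then have *: "a @ r \<in> V F" using V_append_left[of "a @ r" "[i]" F] snoc.prems by simp
    then have "(a @ r, a @ r @ [i]) \<in> edges F" using snoc.prems by (auto simp: edges_def)
    with snoc.IH[OF *] show ?case by (rule rtrancl_into_rtrancl)
  qed simp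
  ultimately show ?thesis unfolding le_h_def by auto
qed

text \<open>No forest occurs as a parameter, so comparisons transfer unchanged between a forest and
  its pieces.\<close>

fun address_less :: "vertex \<Rightarrow> vertex \<Rightarrow> bool" where
  "address_less a [] \<longleftrightarrow> False"
| "address_less [] (j # q) \<longleftrightarrow> True"
| "address_less (i # p) (j # q) \<longleftrightarrow> j < i \<or> i = j \<and> address_less p q"

lemma address_less_Nil [simp]: "address_less [] b \<longleftrightarrow> b \<noteq> []"
  by (cases b) auto

lemma address_less_iff:
  assumes "a \<in> V F" "b \<in> V F"
  shows "address_less a b \<longleftrightarrow> a \<noteq> b \<and> ((\<exists>r. b = a @ r) \<or> le_l F a b)"
  using assms
proof (induction F a b rule: le_l.induct)
  case (1 F i p j q)
  show ?case
  proof (cases "p = [] \<or> q = [] \<or> i \<noteq> j")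
    case True
    then show ?thesis using 1(2-) by (auto simp: le_h_iff)
  next
    case False
    then have "p \<in> V (children (F ! i))" "q \<in> V (children (F ! i))"
      using 1(2-) by auto
    \<comment> \<open>The incomparability demanded by \<open>le_l F\<close> is thus inherited from
      the forest below the common root.\<close>
    moreover have "\<not> (\<exists>r. p = q @ r)" if "le_l (children (F ! i)) p q"
      using that by (cases "(children (F ! i), p, q)" rule: le_l.cases) (auto simp: le_h_iff)
    ultimately show ?thesis using 1 False by (auto simp: le_h_iff)
  qed
qed auto

lemma less_hl_iff: "a \<in> V F \<Longrightarrow> b \<in> V F \<Longrightarrow> less_hl F a b \<longleftrightarrow> address_less a b"
  unfolding less_hl_def le_hl_def by (auto simp: le_h_iff address_less_iff)

lemma B_eq: "a \<in> V F \<Longrightarrow> B F a = induced F {b \<in> V F. address_less a b}"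
  unfolding B_def by (rule arg_cong[where f = "induced F"]) (auto simp: less_hl_iff)

lemma R_eq: "a \<in> V F \<Longrightarrow> R F a = induced F {b \<in> V F. address_less b a}"
  unfolding R_def by (rule arg_cong[where f = "induced F"]) (auto simp: less_hl_iff)

text \<open>Dropping a suffix never makes an address larger; hence the vertices below
  \<open>a\<close> contain their ancestors.\<close>

lemma address_less_append: "address_less (p @ q) a \<Longrightarrow> address_less p a"
  by (induction p a rule: address_less.induct) auto


section \<open>Induced subforests\<close>

lemma induced_empty [simp]: "induced F {} = []"
  by (simp add: induced_def)

text \<open>Besides addresses with first index in range, \<open>induced\<close> tests only
  \<open>[]\<close>, which arises as \<open>butlast\<close> of a root address.\<close>

lemma induced_cong:
  assumes "[] \<in> S \<longleftrightarrow> [] \<in> S'" "\<And>i p. i < length F \<Longrightarrow> i # p \<in> S \<longleftrightarrow> i # p \<in> S'"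
  shows "induced F S = induced F S'"
proof -
  have "p \<in> S \<longleftrightarrow> p \<in> S'" "butlast p \<in> S \<longleftrightarrow> butlast p \<in> S'" "{q. p @ q \<in> S} = {q. p @ q \<in> S'}"
    if "p \<in> V F" for p
    using that assms by (cases p; auto)+
  then show ?thesis
    unfolding induced_def by (intro map_cong filter_cong) (auto simp: V_def)
qed

text \<open>Turns addresses in \<open>F\<close> into addresses in \<open>T # F\<close>. Fixing
  \<open>[]\<close> makes it commute with \<open>butlast\<close>, also at roots.\<close>

fun shift :: "vertex \<Rightarrow> vertex" where
  "shift [] = []"
| "shift (i # p) = Suc i # p"

lemma shift_eq_Nil [simp]: "shift p = [] \<longleftrightarrow> p = []"
  by (cases p) auto

lemma Cons_0_neq_shift [simp]: "0 # q \<noteq> shift p"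
  by (cases p) auto

lemma inj_shift: "inj shift"
proof (rule injI)
  fix p q :: vertex
  assume "shift p = shift q"
  then show "p = q" by (cases p; cases q) auto
qed

lemma vertex_list_Nil [simp]: "vertex_list [] = []"
  by (subst vertex_list.simps) simp

lemma vertex_list_single: "vertex_list [T] = [0] # map ((#) 0) (vertex_list (children T))"
  by (subst vertex_list.simps) simp

lemma vertex_list_Cons: "vertex_list (T # F) = vertex_list [T] @ map shift (vertex_list F)"
proof -
  have *: "[0..<Suc n] = 0 # map Suc [0..<n]" for n
    by (subst upt_conv_Cons) (simp_all add: map_Suc_upt del: upt_Suc)
  show ?thesis
    unfolding vertex_list_single
    by (subst (1 3) vertex_list.simps)
      (simp add: * map_concat comp_def del: upt_Suc)
qed

lemma V_Cons: "V (T # F) = V [T] \<union> shift ` V F"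
  unfolding V_def by (subst vertex_list_Cons) simp

lemma shift_in_V [simp]: "shift p \<in> V (T # F) \<longleftrightarrow> p \<in> V F"
  by (cases p) auto

lemma address_less_shift [simp]: "address_less (shift p) (shift q) \<longleftrightarrow> address_less p q"
  by (induction p q rule: address_less.induct) auto

text \<open>No component meets two trees, and the preorder lists the addresses in \<open>T\<close>
  before the shifted ones.\<close>

lemma induced_Cons: "induced (T # F) S = induced [T] S @ induced F {p. shift p \<in> S}"
proof -
  have "tree_at (T # F) p = tree_at [T] p" if "p \<in> V [T]" for p
    using that by (cases "(T # F, p)" rule: tree_at.cases) auto
  moreover have "tree_at (T # F) (shift p) = tree_at F p \<and> butlast (shift p) = shift (butlast p)
      \<and> {q. shift p @ q \<in> S} = {q. shift (p @ q) \<in> S}" if "p \<in> V F" for p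
    using that by (cases "(F, p)" rule: tree_at.cases) auto
  ultimately show ?thesis
    unfolding induced_def vertex_list_Cons[of T F]
    by (auto simp: filter_map comp_def V_def cong: filter_cong map_cong)
qed

section \<open>Vertex sets closed under ancestors\<close>

lemma filter_roots:
  "filter (\<lambda>p. P p \<and> length p = Suc 0) (vertex_list F) = map (\<lambda>i. [i]) (filter (\<lambda>i. P [i]) [0..<length F])"
proof -
  \<comment> \<open>Below the root \<open>i\<close>, an address of length one would leave the
    remainder \<open>[]\<close>, which is no vertex.\<close>
  have nonroot: "filter (\<lambda>p. P (i # p) \<and> p = []) (vertex_list G) = []" for i and G :: "'a forest"
    using Nil_notin_V[of G] by (auto simp: filter_empty_conv V_def)
  have concat: "concat (map (\<lambda>i. if Q i then [f i] else []) is) = map f (filter Q is)"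
    for Q :: "nat \<Rightarrow> bool" and f :: "nat \<Rightarrow> vertex" and "is"
    by (induction "is") auto
  show ?thesis
    by (subst vertex_list.simps)
      (simp add: filter_concat comp_def filter_map nonroot concat cong: if_cong)
qed

text \<open>The condition \<open>p \<noteq> []\<close> exempts roots, whose parent address
  \<open>[]\<close> is not a vertex.\<close>

definition ancestor_closed :: "vertex set \<Rightarrow> bool" where
  "ancestor_closed S \<longleftrightarrow> [] \<notin> S \<and> (\<forall>p i. p @ [i] \<in> S \<longrightarrow> p \<noteq> [] \<longrightarrow> p \<in> S)"

text \<open>When all ancestors are present, a component can start only at a root of
  \<open>F\<close>.\<close>

lemma induced_ancestor_closed:
  assumes "ancestor_closed S"
  shows "induced F S =
    map (\<lambda>i. root_component {q. i # q \<in> S} (F ! i)) (filter (\<lambda>i. [i] \<in> S) [0..<length F])"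
proof -
  have "p \<in> S \<and> butlast p \<notin> S \<longleftrightarrow> p \<in> S \<and> length p = Suc 0" for p
    using assms by (cases p rule: rev_cases) (auto simp: ancestor_closed_def)
  then show ?thesis
    unfolding induced_def by (simp add: filter_roots comp_def)
qed

lemma ancestor_closed_V: "ancestor_closed (V F)"
  by (auto simp: ancestor_closed_def dest: V_append_left)

lemma ancestor_closed_below: "ancestor_closed {b \<in> V F. address_less b a}"
  by (auto simp: ancestor_closed_def dest: V_append_left address_less_append)

lemma root_component_all:
  "(\<And>p. p \<in> V (children T) \<Longrightarrow> p \<in> S) \<Longrightarrow> root_component S T = T"
proof (induction S T rule: root_component.induct)
  case (2 S ts)
  have "root_component {p. i # p \<in> S} (ts ! i) = ts ! i" if "i < length ts" for i
    using that 2 by (intro "2.IH") auto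
  moreover have "filter (\<lambda>i. [i] \<in> S) [0..<length ts] = [0..<length ts]"
    using 2 by (auto simp: filter_id_conv)
  ultimately have "map (\<lambda>i. root_component {p. i # p \<in> S} (ts ! i)) (filter (\<lambda>i. [i] \<in> S) [0..<length ts])
      = map ((!) ts) [0..<length ts]"
    by (auto intro!: map_cong)
  then show ?case by (simp add: map_nth)
qed simp

lemma induced_V [simp]: "induced F (V F) = F"
proof -
  have "root_component {q. i # q \<in> V F} (F ! i) = F ! i" if "i < length F" for i
    using that by (intro root_component_all) auto
  moreover have "filter (\<lambda>i. [i] \<in> V F) [0..<length F] = [0..<length F]"
    by (auto simp: filter_id_conv)
  ultimately have "induced F (V F) = map ((!) F) [0..<length F]"
    by (auto simp: induced_ancestor_closed[OF ancestor_closed_V] simp del: Cons_in_V intro!: map_cong)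
  then show ?thesis by (simp add: map_nth)
qed

text \<open>Since \<open>[]\<close> is not in \<open>S\<close>, the new root \<open>[0]\<close> is
  omitted, so both sides have the same component roots up to the prefix \<open>0\<close>.\<close>

lemma induced_Graft_rootless:
  assumes "[] \<notin> S"
  shows "induced [Graft F] ((#) 0 ` S) = induced F S"
proof -
  have "0 # p \<in> (#) 0 ` S \<and> butlast (0 # p) \<notin> (#) 0 ` S \<longleftrightarrow> p \<in> S \<and> butlast p \<notin> S"
    and "tree_at [Graft F] (0 # p) = tree_at F p" if "p \<in> V F" for p
    using that assms by (cases p; auto)+
  moreover have "{q. (0 # p) @ q \<in> (#) 0 ` S} = {q. p @ q \<in> S}" for p
    by auto
  ultimately show ?thesis
    unfolding induced_def vertex_list_single using assms
    by (auto simp: filter_map comp_def V_def image_iff cong: filter_cong map_cong)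
qed

lemma induced_Graft_root:
  assumes "ancestor_closed S"
  shows "induced [Graft F] (insert [0] ((#) 0 ` S)) = [Graft (induced F S)]"
proof -
  have "[] \<notin> S" using assms by (simp add: ancestor_closed_def)
  have "ancestor_closed (insert [0] ((#) 0 ` S))"
    using assms unfolding ancestor_closed_def
    by (auto simp: Cons_eq_append_conv append_eq_Cons_conv image_iff)
  \<comment> \<open>The extra \<open>[]\<close> stands for the new root;
    \<open>root_component\<close> queries only nonempty addresses, so the children are those given
    by \<open>S\<close>.\<close>
  moreover have "{q. 0 # q \<in> insert [0] ((#) 0 ` S)} = insert [] S"
    by auto
  ultimately show ?thesis
    by (simp add: induced_ancestor_closed assms)
qed


section \<open>Recursion for the combinatorial coproduct\<close>

lemma V_single: "V [T] = insert [0] ((#) 0 ` V (children T))"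
  by (simp add: V_def vertex_list_single)

section \<open>Prepending a tree\<close>

lemma B_Cons_head:
  assumes "a \<in> V [T]"
  shows "B (T # F) a = B [T] a"
proof -
  obtain p where p: "a = 0 # p" using assms by (auto simp: V_single)
  have "a \<in> V (T # F)" using assms by (simp add: p)
  moreover have "\<not> address_less a (shift b)" for b
    unfolding p by (cases b) auto
  \<comment> \<open>Within \<open>[T]\<close> only the index \<open>0\<close> is in range, and there
    \<open>V (T # F)\<close> and \<open>V [T]\<close> agree.\<close>
  moreover have "induced [T] {b \<in> V (T # F). address_less a b} = induced [T] {b \<in> V [T]. address_less a b}"
    by (rule induced_cong) auto
  ultimately show ?thesis using assms by (simp add: B_eq induced_Cons[of T F])
qed

lemma R_Cons_head:
  assumes "a \<in> V [T]"
  shows "R (T # F) a = R [T] a @ F"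
proof -
  obtain p where p: "a = 0 # p" using assms by (auto simp: V_single)
  have "a \<in> V (T # F)" using assms by (simp add: p)
  moreover have "{b. shift b \<in> V (T # F) \<and> address_less (shift b) a} = V F"
  proof -
    have "address_less (shift b) a" if "b \<in> V F" for b
      using that unfolding p by (cases b) auto
    then show ?thesis by auto
  qed
  moreover have "induced [T] {b \<in> V (T # F). address_less b a} = induced [T] {b \<in> V [T]. address_less b a}"
    by (rule induced_cong) auto
  ultimately show ?thesis using assms by (simp add: R_eq induced_Cons[of T F])
qed

lemma B_Cons_tail:
  assumes "a \<in> V F"
  shows "B (T # F) (shift a) = T # B F a"
proof -
  obtain i p where p: "a = i # p" using assms by (cases a) auto
  \<comment> \<open>The first index of \<open>shift a\<close> is positive, so every address starting
    with \<open>0\<close> is larger.\<close>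
  have "induced [T] {b \<in> V (T # F). address_less (shift a) b} = induced [T] (V [T])"
    by (rule induced_cong) (auto simp: p)
  then show ?thesis using assms by (simp add: B_eq induced_Cons[of T F])
qed

lemma R_Cons_tail:
  assumes "a \<in> V F"
  shows "R (T # F) (shift a) = R F a"
proof -
  obtain i p where p: "a = i # p" using assms by (cases a) auto
  have "induced [T] {b \<in> V (T # F). address_less b (shift a)} = induced [T] {}"
    by (rule induced_cong) (auto simp: p)
  then show ?thesis using assms by (simp add: R_eq induced_Cons[of T F])
qed

section \<open>Grafting onto a new root\<close>

lemma B_Graft_root: "B [Graft F] [0] = F"
proof -
  have "{b \<in> V [Graft F]. address_less [0] b} = (#) 0 ` V F"
    by (auto simp: V_single)
  then show ?thesis by (simp add: B_eq induced_Graft_rootless)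
qed

lemma R_root: "R [T] [0] = []"
proof -
  have empty: "{b \<in> V [T]. address_less b [0]} = {}"
    by (auto simp: V_single)
  have "R [T] [0] = induced [T] {b \<in> V [T]. address_less b [0]}"
    by (rule R_eq) simp
  then show ?thesis unfolding empty by simp
qed

lemma B_Graft:
  assumes "a \<in> V F"
  shows "B [Graft F] (0 # a) = B F a"
proof -
  have "{b \<in> V [Graft F]. address_less (0 # a) b} = (#) 0 ` {b \<in> V F. address_less a b}"
    by (auto simp: V_single)
  then show ?thesis using assms by (simp add: B_eq induced_Graft_rootless)
qed

lemma R_Graft:
  assumes "a \<in> V F"
  shows "R [Graft F] (0 # a) = [Graft (R F a)]"
proof -
  \<comment> \<open>This puts \<open>[0]\<close> strictly below \<open>0 # a\<close>, so the new
    root belongs to \<open>R\<close>.\<close>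
  have "a \<noteq> []" using assms by auto
  then have "{b \<in> V [Graft F]. address_less b (0 # a)} = insert [0] ((#) 0 ` {b \<in> V F. address_less b a})"
    by (auto simp: V_single)
  then show ?thesis using assms by (simp add: R_eq induced_Graft_root ancestor_closed_below)
qed

lemma Delta_forest_eq:
  "Delta_forest F = (\<Sum>a\<in>V F. basis (B F a) \<otimes> basis (R F a)
      :: ('x, 'k::{comm_ring, comm_monoid_mult}) H2)"
proof (induction F rule: Delta_forest.induct)
  case 1
  show ?case by (simp add: V_def)
next
  case (2 x)
  have V: "V [Leaf x] = {[0]}" by (simp add: V_def vertex_list_single)
  then have empty: "{b \<in> V [Leaf x]. address_less [0] b} = {}" by auto
  have "B [Leaf x] [0] = induced [Leaf x] {b \<in> V [Leaf x]. address_less [0] b}"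
    by (rule B_eq) simp
  then have "B [Leaf x] [0] = []" unfolding empty by simp
  then show ?case by (simp add: V R_root)
next
  case (3 F)
  \<comment> \<open>Lets the root's summand split off as the first term of the grafting
    clause.\<close>
  have "[0] \<notin> (#) 0 ` V F" by auto
  then have "(\<Sum>a\<in>V [Graft F]. basis (B [Graft F] a) \<otimes> basis (R [Graft F] a)) =
      basis F \<otimes> basis [] +
      (\<Sum>a\<in>V F. basis (B F a) \<otimes> basis [Graft (R F a)] :: ('x, 'k) H2)"
    by (simp add: V_single sum.reindex B_Graft_root R_root B_Graft R_Graft)
  then show ?case
    by (simp add: 3 tensor_map_sum tensor_map_basis Bplus_basis)
next
  case (4 T T' Ts)
  let ?F = "T' # Ts"
  \<comment> \<open>Disjointness splits the sum into vertices of \<open>T\<close> and of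
    \<open>?F\<close>; injectivity of \<open>shift\<close> reindexes the second part.\<close>
  have "V [T] \<inter> shift ` V ?F = {}"
    by (auto simp: V_single)
  moreover have "inj_on shift (V ?F)"
    using inj_shift by (rule inj_on_subset) simp
  ultimately have "(\<Sum>a\<in>V (T # ?F). basis (B (T # ?F) a) \<otimes> basis (R (T # ?F) a)) =
      (\<Sum>a\<in>V [T]. basis (B [T] a) \<otimes> basis (R [T] a @ ?F)) +
      (\<Sum>a\<in>V ?F. basis (T # B ?F a) \<otimes> basis (R ?F a) :: ('x, 'k) H2)"
    unfolding V_Cons[of T ?F]
    by (simp add: sum.union_disjoint sum.reindex
      B_Cons_head[where F = ?F] R_Cons_head[where F = ?F] B_Cons_tail R_Cons_tail)
  \<comment> \<open>The left action accounts for the vertices of \<open>?F\<close>, the right action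
    for those of \<open>T\<close>; \<open>Delta_forest\<close> lists them in the opposite
    order.\<close>
  then show ?case
    by (simp add: 4 lact_def ract_def tensor_map_sum tensor_map_basis hmult_basis add.commute)
qed

theorem proposition2p12:
  fixes F :: "'x forest"
  shows "(Delta (basis F) :: ('x, 'k::{comm_ring, comm_monoid_mult}) H2)
    = (\<Sum>a\<in>V F. basis (B F a) \<otimes> basis (R F a))"
  by (simp add: Delta_def Delta_forest_eq)

end
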